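(* Let $F(\cdot;\theta)$, $\theta\in\Theta$, be an exponential family of the first type with functions $A$ and $B$ and density $f_\theta(x)=f(x;\theta)$; write $F_\theta(x)=F(x;\theta)$. Suppose a random sample $(X_1,\dots,X_n)$ from $F(\cdot;\theta)$ has $m$ upper record values $(R_1,\dots,R_m)$. Then the maximum likelihood estimators of the CDF and PDF based on the upper record values are consistent; that is, for each $x$, as $m\to\infty$, (i) $\hat f_{MLE,(R_1,\dots,R_m)}(x)\xrightarrow{P}f_\theta(x)$; (ii) $\hat F_{MLE,(R_1,\dots,R_m)}(x)\xrightarrow{P}F_\theta(x)$, where $\xrightarrow{P}$ denotes convergence in probability under the true parameter $\theta$.
   Context: Exponential family of the first type: the family of distributions with cumulative distribution function $F(x;\theta)=1-\exp\{-B(\theta)A(x)\}$ for $x\in[a,b]$, where $A$ is an increasing differentiable function with $A(a)=0$, $A(b)=+\infty$ ($b=+\infty$ is allowed), and $B(\theta)>0$. The density is $f(x;\theta)=A'(x)B(\theta)\exp\{-A(x)B(\theta)\}$. The parameter set $\Theta\subseteq\mathbb{R}$ is an interval and $B:\Theta\to\mathbb{R}$ is twice differentiable and one-to-one. A random sample is an i.i.d. sample. Upper record values: $R_1=X_1$, and subsequent upper records are the successive observations of an i.i.d. sequence from $F(\cdot;\theta)$ that exceed all previous observations. The joint density of the first $m$ upper record values is taken to be $f(r_m;\theta)\prod_{i=1}^{m-1}h(r_i;\theta)=B^m(\theta)\left\{\prod_{i=1}^mA'(r_i)\right\}\exp\{-B(\theta)A(r_m)\}$ for $r_1<\dots<r_m$,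 where $h=f/(1-F)$; in particular $A(R_m)$ has the Gamma distribution with shape $m$ and scale $1/B(\theta)$. Estimators (for fixed $x$): $\hat f_{MLE,(R_1,\dots,R_m)}(x)=\frac{mA'(x)}{A(R_m)}\exp\left(-\frac{mA(x)}{A(R_m)}\right)$, $\hat F_{MLE,(R_1,\dots,R_m)}(x)=1-\exp\left(-\frac{mA(x)}{A(R_m)}\right)$. *)

theory Defs
  imports "HOL-Probability.Probability"
begin

definition twice_differentiable_on :: "(real \<Rightarrow> real) \<Rightarrow> real set \<Rightarrow> bool" where
  "twice_differentiable_on g S \<longleftrightarrow>
    (\<exists>g'. (\<forall>t\<in>S. (g has_real_derivative g' t) (at t within S)) \<and> g' differentiable_on S)"

text \<open>
  The right end point may be infinite, so it is an extended real. Since \<open>A b = \<infinity>\<close>, the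
  real-valued \<open>A\<close> lives on \<open>[a, b)\<close>; \<open>A b = \<infinity>\<close> is read as a limit from the left.
\<close>

definition support :: "real \<Rightarrow> ereal \<Rightarrow> real set" where
  "support a b = {x. a \<le> x \<and> ereal x < b}"

text \<open>
  \<open>A'\<close> is the derivative of \<open>A\<close>; at \<open>a\<close> it is the right derivative. The weak reading of
  ``increasing'' is used, which also covers strictly increasing \<open>A\<close>. The composition
  with \<^const>\<open>real_of_ereal\<close> is the usual way to express a limit at an end point that is
  possibly infinite.
\<close>

locale exponential_family_first_type =
  fixes a :: real and b :: ereal and A A' :: "real \<Rightarrow> real"
    and B :: "real \<Rightarrow> real" and \<Theta> :: "real set"
  assumes end_points: "ereal a < b"
    and A_mono: "mono_on (support a b) A"
    and A_deriv: "\<And>x. x \<in> support a b \<Longrightarrow>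
      (A has_real_derivative A' x) (at x within support a b)"
    and A_left: "A a = 0"
    and A_right: "filterlim (A \<circ> real_of_ereal) at_top (at_left b)"
    and param_interval: "is_interval \<Theta>"
    and B_pos: "\<And>t. t \<in> \<Theta> \<Longrightarrow> 0 < B t"
    and B_inj: "inj_on B \<Theta>"
    and B_diff: "twice_differentiable_on B \<Theta>"

text \<open>The distribution and density functions, given on the whole real line.\<close>

definition family_cdf ::
  "real \<Rightarrow> ereal \<Rightarrow> (real \<Rightarrow> real) \<Rightarrow> (real \<Rightarrow> real) \<Rightarrow> real \<Rightarrow> real \<Rightarrow> real" where
  "family_cdf a b A B \<theta> x =
    (if x < a then 0 else if ereal x < b then 1 - exp (- (B \<theta> * A x)) else 1)"

definition family_pdf ::
  "real \<Rightarrow> ereal \<Rightarrow> (real \<Rightarrow> real) \<Rightarrow> (real \<Rightarrow> real) \<Rightarrow> (real \<Rightarrow> real) \<Rightarrow> real \<Rightarrow> real \<Rightarrow> real" where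
  "family_pdf a b A A' B \<theta> x =
    (if x \<in> support a b then A' x * B \<theta> * exp (- (A x * B \<theta>)) else 0)"

text \<open>
  Upper records of a sequence \<open>x 0, x 1, \<dots>\<close>: index \<open>j\<close> is a record time if \<open>x j\<close> exceeds all
  previous terms, so \<open>0\<close> always is one. Record values are numbered from \<open>1\<close>, hence
  \<open>upper_record x 1 = x 0\<close>. If there are fewer than \<open>m\<close> records (an event of probability
  zero for the samples considered here), \<open>upper_record x m\<close> has no meaning.
\<close>

definition record_times :: "(nat \<Rightarrow> real) \<Rightarrow> nat set" where
  "record_times x = {j. \<forall>i<j. x i < x j}"

definition upper_record :: "(nat \<Rightarrow> real) \<Rightarrow> nat \<Rightarrow> real" where
  "upper_record x m = x (enumerate (record_times x) (m - 1))"

text \<open>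
  The estimators, as functions of the sequence \<open>r\<close> of record values, of which only \<open>r m\<close>
  enters. The values of the parameter \<open>A\<close> outside the support are unspecified, and an
  observation may fall there with probability zero; \<open>A\<close> is therefore evaluated at \<open>r m\<close>
  through its extension by zero, so that the estimators are random variables.
\<close>

definition zero_ext :: "real \<Rightarrow> ereal \<Rightarrow> (real \<Rightarrow> real) \<Rightarrow> real \<Rightarrow> real" where
  "zero_ext a b A x = (if x \<in> support a b then A x else 0)"

definition pdf_MLE ::
  "real \<Rightarrow> ereal \<Rightarrow> (real \<Rightarrow> real) \<Rightarrow> (real \<Rightarrow> real) \<Rightarrow> nat \<Rightarrow> (nat \<Rightarrow> real) \<Rightarrow> real \<Rightarrow> real" where
  "pdf_MLE a b A A' m r x =
    (if x \<in> support a b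
     then real m * A' x / zero_ext a b A (r m) * exp (- (real m * A x / zero_ext a b A (r m)))
     else 0)"

definition cdf_MLE ::
  "real \<Rightarrow> ereal \<Rightarrow> (real \<Rightarrow> real) \<Rightarrow> nat \<Rightarrow> (nat \<Rightarrow> real) \<Rightarrow> real \<Rightarrow> real" where
  "cdf_MLE a b A m r x =
    (if x < a then 0
     else if ereal x < b then 1 - exp (- (real m * A x / zero_ext a b A (r m)))
     else 1)"

definition converges_in_probability ::
  "'a measure \<Rightarrow> (nat \<Rightarrow> 'a \<Rightarrow> real) \<Rightarrow> real \<Rightarrow> bool" where
  "converges_in_probability M Y c \<longleftrightarrow>
    (\<forall>m. Y m \<in> borel_measurable M) \<and>
    (\<forall>\<epsilon>>0. (\<lambda>m. measure M {\<omega> \<in> space M. \<bar>Y m \<omega> - c\<bar> > \<epsilon>}) \<longlonglongrightarrow> 0)"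

end

theory Submission
  imports Defs
begin

text \<open>
  Write \<open>\<lambda> = B \<theta>\<close>. For a measurable \<open>f \<ge> 0\<close>, conditioning on the record \<open>R\<^sub>m = x\<close> and summing a geometric
  series over the waiting time until the next record gives
  \<open>E f(R\<^sub>m\<^sub>+\<^sub>1) = E h(R\<^sub>m)\<close> with \<open>h(x) = E[f(X) | X > x]\<close>. For \<open>f = exp(- s A)\<close> the loss of memory of
  the exponential variable \<open>A(X)\<close> yields \<open>h = \<lambda> / (\<lambda> + s) \<cdot> f\<close>, hence \<open>E exp(- s A(R\<^sub>m)) = (\<lambda> / (\<lambda> + s))\<^sup>m\<close>;
  the case \<open>s = 0\<close> says that almost surely the \<open>m\<close>-th record exists.
  Consequently \<open>Z\<^sub>m = exp(- A(R\<^sub>m) / m)\<close> has first and second moments converging to \<open>c\<close> and \<open>c\<^sup>2\<close>, where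
  \<open>c = exp(- 1 / \<lambda>)\<close>. So \<open>Z\<^sub>m\<close> converges to \<open>c\<close> in mean square, and both estimators are functions of \<open>Z\<^sub>m\<close>
  that are continuous at \<open>c\<close>, because \<open>m / A(R\<^sub>m) = - 1 / ln Z\<^sub>m\<close>.
\<close>

section \<open>Records of sequences\<close>

text \<open>Induction on \<open>m\<close>: \<open>enumerate\<close> strips the least element of
  \<open>S\<close>; for positive \<open>m\<close> that element lies below \<open>j\<close>, so one
  predecessor of \<open>j\<close> disappears.\<close>

lemma enumerate_eqI:
  fixes S :: "nat set"
  assumes "j \<in> S" "card (S \<inter> {..<j}) = m"
  shows "enumerate S m = j"
  using assms
proof (induction m arbitrary: S)
  case 0
  then have "S \<inter> {..<j} = {}" by simp
  with 0 have "(LEAST n. n \<in> S) = j" by (intro Least_equality) (auto simp: not_less[symmetric])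
  then show ?case by (simp add: enumerate_0)
next
  case (Suc m)
  define l where "l = (LEAST n. n \<in> S)"
  have l: "l \<in> S" unfolding l_def using Suc.prems(1) by (rule LeastI)
  have "S \<inter> {..<j} \<noteq> {}" using Suc.prems(2) by auto
  then obtain i where "i \<in> S" "i < j" by auto
  then have "l < j" using Least_le[of "\<lambda>n. n \<in> S" i] unfolding l_def by linarith
  moreover have "(S - {l}) \<inter> {..<j} = (S \<inter> {..<j}) - {l}" by auto
  ultimately have "card ((S - {l}) \<inter> {..<j}) = m"
    using Suc.prems l by simp
  then have "enumerate (S - {l}) m = j"
    using Suc.prems(1) \<open>l < j\<close> by (intro Suc.IH) auto
  then show ?case by (simp add: l_def enumerate_Suc)
qed

text \<open>The induction runs over all random sets, because unfolding \<open>enumerate\<close> once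
  replaces \<open>S x\<close> by \<open>S x\<close> without its random least element.\<close>

lemma measurable_enumerate:
  fixes S :: "'a \<Rightarrow> nat set"
  assumes [measurable]: "\<And>n. Measurable.pred M (\<lambda>x. n \<in> S x)"
  shows "(\<lambda>x. enumerate (S x) k) \<in> M \<rightarrow>\<^sub>M count_space UNIV"
  using assms
proof (induction k arbitrary: S)
  case 0
  note [measurable] = 0
  show ?case by (simp add: enumerate_0)
next
  case (Suc k)
  note [measurable] = Suc.prems
  have "(\<lambda>x. enumerate (S x - {LEAST n. n \<in> S x}) k) \<in> M \<rightarrow>\<^sub>M count_space UNIV"
    by (rule Suc.IH) simp
  then show ?case by (simp add: enumerate_Suc)
qed

text \<open>Index \<open>j\<close> carries the record number \<open>m + 1\<close>.\<close>

primrec record_at :: "nat \<Rightarrow> (nat \<Rightarrow> real) \<Rightarrow> nat \<Rightarrow> bool" where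
  "record_at 0 x k \<longleftrightarrow> k = 0"
| "record_at (Suc m) x k \<longleftrightarrow>
    (\<exists>j<k. record_at m x j \<and> (\<forall>l\<in>{j<..<k}. x l \<le> x j) \<and> x j < x k)"

text \<open>The index \<open>i\<close> from the recursion is the last record time before
  \<open>j\<close>, so the record times below \<open>j\<close> are \<open>i\<close> and those below
  \<open>i\<close>.\<close>

lemma record_at_imp:
  "record_at m x j \<Longrightarrow> j \<in> record_times x \<and> card (record_times x \<inter> {..<j}) = m"
proof (induction m arbitrary: j)
  case 0
  then show ?case by (simp add: record_times_def)
next
  case (Suc m)
  then obtain i where i: "i < j" "record_at m x i" "\<forall>l\<in>{i<..<j}. x l \<le> x i" "x i < x j"
    by auto
  from Suc.IH[OF i(2)] have IH: "\<forall>l<i. x l < x i" "i \<in> record_times x"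
    "card (record_times x \<inter> {..<i}) = m"
    by (auto simp: record_times_def)
  have "x l < x j" if "l < j" for l
  proof -
    consider "l < i" | "l = i" | "l \<in> {i<..<j}" using \<open>l < j\<close> by (auto intro: linorder_cases[of l i])
    then show ?thesis using i(3,4) IH(1) by cases fastforce+
  qed
  then have "j \<in> record_times x" by (simp add: record_times_def)
  moreover have "record_times x \<inter> {..<j} = insert i (record_times x \<inter> {..<i})"
  proof -
    have "l \<notin> record_times x" if "i < l" "l < j" for l
      using i(3) that by (force simp: record_times_def)
    then show ?thesis using i(1) IH(2) by (auto simp: not_less) (meson linorder_cases)
  qed
  ultimately show ?case using IH(3) by simp
qed

text \<open>Yields that at most one \<open>j\<close> satisfies \<open>record_at m x j\<close>, which
  is why sums of indicators over \<open>j\<close> later collapse to a single term.\<close>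

lemma enumerate_record_at: "record_at m x j \<Longrightarrow> enumerate (record_times x) m = j"
  using record_at_imp enumerate_eqI by blast

text \<open>Lets the full sequence be replaced by the vector of past observations, to which
  independence applies.\<close>

lemma record_at_cong: "(\<And>i. i \<le> j \<Longrightarrow> x i = y i) \<Longrightarrow> record_at m x j = record_at m y j"
proof (induction m arbitrary: j)
  case (Suc m)
  have "record_at m x i = record_at m y i" if "i < j" for i
    using that Suc.prems by (intro Suc.IH) auto
  moreover have "x i = y i" if "i \<le> j" for i using Suc.prems that by auto
  ultimately show ?case by (auto simp: Bex_def)
qed simp

section \<open>Measurability of record events\<close>

lemma
  fixes i l :: nat
  assumes "i \<in> I" "l \<in> I"
  shows measurable_component_le: "Measurable.pred (PiM I (\<lambda>_. borel :: real measure)) (\<lambda>x. x l \<le> x i)" (is ?le)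
    and measurable_component_less: "Measurable.pred (PiM I (\<lambda>_. borel :: real measure)) (\<lambda>x. x l < x i)" (is ?less)
proof -
  have [measurable]: "(\<lambda>x. x i) \<in> borel_measurable (PiM I (\<lambda>_. borel :: real measure))"
    "(\<lambda>x. x l) \<in> borel_measurable (PiM I (\<lambda>_. borel :: real measure))"
    using assms by (auto intro: measurable_component_singleton)
  show ?le unfolding pred_def by (rule borel_measurable_le) measurable
  show ?less by measurable
qed

text \<open>The index set is general to cover both the finite past \<open>{..<k}\<close> and the
  whole sequence.\<close>

lemma measurable_record_at:
  assumes "{..j} \<subseteq> I"
  shows "Measurable.pred (PiM I (\<lambda>_. borel)) (\<lambda>x. record_at m x j)"
  using assms
proof (induction m arbitrary: j)
  case (Suc m)
  have [measurable]: "Measurable.pred (PiM I (\<lambda>_. borel)) (\<lambda>x. record_at m x i)" if "i \<in> {..<j}" for i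
    using that Suc.prems by (intro Suc.IH) auto
  have [measurable]: "(\<lambda>x. x i) \<in> borel_measurable (PiM I (\<lambda>_. borel))" if "i \<in> {..j}" for i
    using that Suc.prems by (intro measurable_component_singleton) auto
  have "Measurable.pred (PiM I (\<lambda>_. borel)) (\<lambda>x. \<exists>i\<in>{..<j}. record_at m x i \<and>
      (\<forall>l\<in>{i<..<j}. x l \<le> x i) \<and> x i < x j)"
    using Suc.prems
    by (intro pred_intros_finite pred_intros_logic measurable_component_le measurable_component_less) auto
  then show ?case by (simp only: record_at.simps Bex_def lessThan_iff)
qed simp

section \<open>Series and integrals\<close>

text \<open>Pad with zeros, interchange the sums, substitute \<open>k = Suc j + d\<close>. In the
  application \<open>j\<close> and \<open>k\<close> are successive record times and \<open>d\<close>
  counts the observations strictly between them.\<close>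

lemma suminf_triangle:
  fixes g :: "nat \<Rightarrow> nat \<Rightarrow> ennreal"
  shows "(\<Sum>k. \<Sum>j<k. g j (k - Suc j)) = (\<Sum>j. \<Sum>d. g j d)"
proof -
  define h where "h k j = (if j < k then g j (k - Suc j) else 0)" for k j
  have "(\<Sum>k. \<Sum>j<k. g j (k - Suc j)) = (\<Sum>k. \<Sum>j. h k j)"
    by (intro suminf_cong) (subst suminf_finite[of "{..<_}"], auto simp: h_def)
  \<comment> \<open>One sum is read as an integral over the counting measure, which commutes with
    series of nonnegative terms.\<close>
  also have "\<dots> = (\<Sum>j. \<Sum>k. h k j)"
    using nn_integral_suminf[of "\<lambda>j k. h k j" "count_space (UNIV :: nat set)"]
    by (simp add: nn_integral_count_space_nat)
  also have "\<dots> = (\<Sum>j. \<Sum>d. g j d)"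
  proof (rule suminf_cong)
    fix j
    have "(\<Sum>d. h (Suc j + d) j) = (\<Sum>k. h k j)"
    proof (rule suminf_mono_reindex)
      show "h k j = 0" if "k \<notin> range ((+) (Suc j))" for k
      proof (rule ccontr)
        assume "h k j \<noteq> 0"
        then have "k = Suc j + (k - Suc j)" by (auto simp: h_def split: if_splits)
        with that show False by blast
      qed
    qed (simp add: strict_mono_def)
    then show "(\<Sum>k. h k j) = (\<Sum>d. g j d)" by (simp add: h_def)
  qed
  finally show ?thesis .
qed

lemma suminf_geometric_ennreal:
  assumes "0 < p" "p \<le> 1"
  shows "(\<Sum>d. ennreal (1 - p) ^ d) = ennreal (1 / p)"
proof -
  have "(\<Sum>d. ennreal ((1 - p) ^ d)) = ennreal (\<Sum>d. (1 - p) ^ d)"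
    using assms by (intro suminf_ennreal2 summable_geometric) auto
  also have "(\<Sum>d. (1 - p) ^ d) = 1 / p"
    using assms by (subst suminf_geometric) auto
  finally show ?thesis using assms by (simp add: ennreal_power)
qed

lemma nn_integral_of_bool:
  assumes [measurable]: "Measurable.pred N P"
  shows "(\<integral>\<^sup>+x. of_bool (P x) \<partial>N) = emeasure N {x\<in>space N. P x}"
proof -
  have "(\<integral>\<^sup>+x. of_bool (P x) \<partial>N) = (\<integral>\<^sup>+x. indicator {x\<in>space N. P x} x \<partial>N)"
    by (intro nn_integral_cong) (auto simp: indicator_def)
  then show ?thesis by simp
qed

section \<open>Records of independent identically distributed samples\<close>

locale iid_sequence = prob_space M for M :: "'a measure" +
  fixes X :: "nat \<Rightarrow> 'a \<Rightarrow> real" and D :: "real measure"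
  assumes indep: "indep_vars (\<lambda>_. borel) X UNIV"
    and law: "\<And>i. distr M borel (X i) = D"
begin

lemma X_measurable [measurable]: "X i \<in> borel_measurable M"
  using indep by (auto simp: indep_vars_def)

lemma sets_D [measurable_cong, simp]: "sets D = sets borel"
  by (simp flip: law[of 0])

lemma space_D [simp]: "space D = UNIV"
  by (simp flip: law[of 0])

sublocale D: prob_space D
  by (simp flip: law[of 0] add: prob_space_distr)

text \<open>The past and \<open>X k\<close> are independent, so their joint law is a product measure
  and Tonelli's theorem integrates out \<open>X k\<close> first.\<close>

lemma nn_integral_peel:
  fixes g :: "(nat \<Rightarrow> real) \<times> real \<Rightarrow> ennreal"
  assumes [measurable]: "g \<in> borel_measurable (PiM {..<k} (\<lambda>_. borel) \<Otimes>\<^sub>M borel)"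
  shows "(\<integral>\<^sup>+\<omega>. g (\<lambda>i\<in>{..<k}. X i \<omega>, X k \<omega>) \<partial>M) =
    (\<integral>\<^sup>+\<omega>. \<integral>\<^sup>+y. g (\<lambda>i\<in>{..<k}. X i \<omega>, y) \<partial>D \<partial>M)"
proof -
  let ?P = "PiM {..<k} (\<lambda>_. borel :: real measure)"
  let ?past = "\<lambda>\<omega>. \<lambda>i\<in>{..<k}. X i \<omega>"
  let ?Q = "PiM {k} (\<lambda>_. borel :: real measure)"
  let ?last = "\<lambda>\<omega>. \<lambda>i\<in>{k}. X i \<omega>"
  \<comment> \<open>Independence of disjoint blocks concerns vectors, so \<open>X k\<close> enters
    as a vector indexed by \<open>{k}\<close>.\<close>
  have "indep_var ?P ?past ?Q ?last"
    by (rule indep_var_restrict[OF indep]) auto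
  then have eq: "distr M ?P ?past \<Otimes>\<^sub>M distr M ?Q ?last = distr M (?P \<Otimes>\<^sub>M ?Q) (\<lambda>\<omega>. (?past \<omega>, ?last \<omega>))"
    by (simp add: indep_var_distribution_eq)
  interpret L: prob_space "distr M ?Q ?last" by (rule prob_space_distr) measurable
  have "(\<integral>\<^sup>+\<omega>. g (?past \<omega>, X k \<omega>) \<partial>M) =
      (\<integral>\<^sup>+z. g (fst z, snd z k) \<partial>distr M (?P \<Otimes>\<^sub>M ?Q) (\<lambda>\<omega>. (?past \<omega>, ?last \<omega>)))"
    by (subst nn_integral_distr) auto
  also have "\<dots> = (\<integral>\<^sup>+p. \<integral>\<^sup>+f. g (p, f k) \<partial>distr M ?Q ?last \<partial>distr M ?P ?past)"
    unfolding eq[symmetric] by (subst L.nn_integral_fst[symmetric]) auto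
  also have "\<dots> = (\<integral>\<^sup>+p. \<integral>\<^sup>+\<omega>. g (p, X k \<omega>) \<partial>M \<partial>distr M ?P ?past)"
    by (intro nn_integral_cong) (subst nn_integral_distr, auto)
  also have "\<dots> = (\<integral>\<^sup>+p. \<integral>\<^sup>+y. g (p, y) \<partial>D \<partial>distr M ?P ?past)"
    unfolding law[of k, symmetric] by (intro nn_integral_cong) (subst nn_integral_distr, auto)
  also have "\<dots> = (\<integral>\<^sup>+\<omega>. \<integral>\<^sup>+y. g (?past \<omega>, y) \<partial>D \<partial>M)"
    by (subst nn_integral_distr) auto
  finally show ?thesis .
qed

lemma measurable_emeasure_atMost [measurable]: "(\<lambda>x. emeasure D {..x}) \<in> borel_measurable borel"
proof -
  have "(\<lambda>x. \<integral>\<^sup>+y. of_bool (y \<le> x) \<partial>D) \<in> borel_measurable borel" by measurable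
  moreover have "(\<integral>\<^sup>+y. of_bool (y \<le> x) \<partial>D) = emeasure D {..x}" for x
    by (simp add: nn_integral_of_bool atMost_def)
  ultimately show ?thesis by simp
qed

lemma measurable_record_at_X [measurable]:
  "Measurable.pred M (\<lambda>\<omega>. record_at m (\<lambda>i. X i \<omega>) j)"
proof -
  have "(\<lambda>\<omega>. \<lambda>i\<in>UNIV. X i \<omega>) \<in> M \<rightarrow>\<^sub>M PiM UNIV (\<lambda>_. borel)" by measurable
  from measurable_compose[OF this measurable_record_at[of j UNIV m]] show ?thesis
    by (simp add: restrict_UNIV)
qed

text \<open>The indicator is decided by the observations before \<open>k\<close>, so it leaves the
  inner integral over the value of \<open>X k\<close>.\<close>

lemma nn_integral_peel_record:
  fixes \<psi> :: "real \<times> real \<Rightarrow> ennreal"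
  assumes [measurable]: "\<psi> \<in> borel_measurable (borel \<Otimes>\<^sub>M borel)" and jk: "j < k"
  shows "(\<integral>\<^sup>+\<omega>. of_bool (record_at m (\<lambda>i. X i \<omega>) j \<and> (\<forall>l\<in>{j<..<k}. X l \<omega> \<le> X j \<omega>))
        * \<psi> (X j \<omega>, X k \<omega>) \<partial>M) =
    (\<integral>\<^sup>+\<omega>. of_bool (record_at m (\<lambda>i. X i \<omega>) j \<and> (\<forall>l\<in>{j<..<k}. X l \<omega> \<le> X j \<omega>))
        * (\<integral>\<^sup>+y. \<psi> (X j \<omega>, y) \<partial>D) \<partial>M)"
proof -
  define W where "W p = (of_bool (record_at m p j \<and> (\<forall>l\<in>{j<..<k}. p l \<le> p j)) :: ennreal)" for p
  have [measurable]: "Measurable.pred (PiM {..<k} (\<lambda>_. borel)) (\<lambda>p. record_at m p j)"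
    using jk by (intro measurable_record_at) auto
  have [measurable]: "(\<lambda>p. p j) \<in> borel_measurable (PiM {..<k} (\<lambda>_. borel))"
    using jk by (intro measurable_component_singleton) simp
  have [measurable]: "(\<lambda>z. fst z j) \<in> borel_measurable (PiM {..<k} (\<lambda>_. borel) \<Otimes>\<^sub>M (borel :: real measure))"
    using jk by (intro measurable_compose[OF measurable_fst] measurable_component_singleton) simp
  have [measurable]: "Measurable.pred (PiM {..<k} (\<lambda>_. borel :: real measure)) (\<lambda>p. \<forall>l\<in>{j<..<k}. p l \<le> p j)"
    using jk by (intro pred_intros_finite measurable_component_le) auto
  have [measurable]: "W \<in> borel_measurable (PiM {..<k} (\<lambda>_. borel))"
    unfolding W_def by measurable
  have past: "W (\<lambda>i\<in>{..<k}. X i \<omega>) = W (\<lambda>i. X i \<omega>)" for \<omega>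
  proof -
    have "record_at m (\<lambda>i\<in>{..<k}. X i \<omega>) j = record_at m (\<lambda>i. X i \<omega>) j"
      using jk by (intro record_at_cong) simp
    then show ?thesis using jk by (simp add: W_def)
  qed
  have "(\<integral>\<^sup>+\<omega>. W (\<lambda>i. X i \<omega>) * \<psi> (X j \<omega>, X k \<omega>) \<partial>M)
      = (\<integral>\<^sup>+\<omega>. (\<lambda>z. W (fst z) * \<psi> (fst z j, snd z)) (\<lambda>i\<in>{..<k}. X i \<omega>, X k \<omega>) \<partial>M)"
    using jk by (simp add: past)
  also have "\<dots> = (\<integral>\<^sup>+\<omega>. \<integral>\<^sup>+y. W (\<lambda>i. X i \<omega>) * \<psi> (X j \<omega>, y) \<partial>D \<partial>M)"
    using jk by (subst nn_integral_peel, measurable) (simp add: past)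
  also have "\<dots> = (\<integral>\<^sup>+\<omega>. W (\<lambda>i. X i \<omega>) * (\<integral>\<^sup>+y. \<psi> (X j \<omega>, y) \<partial>D) \<partial>M)"
  proof (intro nn_integral_cong)
    fix \<omega>
    have "(\<lambda>y. \<psi> (X j \<omega>, y)) \<in> borel_measurable borel"
      by (rule measurable_compose[OF measurable_Pair1' assms(1)]) simp
    then have "(\<lambda>y. \<psi> (X j \<omega>, y)) \<in> borel_measurable D"
      by (simp cong: measurable_cong_sets)
    then show "(\<integral>\<^sup>+y. W (\<lambda>i. X i \<omega>) * \<psi> (X j \<omega>, y) \<partial>D) = W (\<lambda>i. X i \<omega>) * (\<integral>\<^sup>+y. \<psi> (X j \<omega>, y) \<partial>D)"
      by (rule nn_integral_cmult)
  qed
  finally show ?thesis by (simp add: W_def)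
qed

section \<open>Waiting times between records\<close>

text \<open>Integrating out \<open>X (j + d)\<close>, \<dots>, \<open>X (j + 1)\<close> one after the other.\<close>

lemma nn_integral_gap:
  fixes \<phi> :: "real \<Rightarrow> ennreal"
  assumes "\<phi> \<in> borel_measurable borel"
  shows "(\<integral>\<^sup>+\<omega>. of_bool (record_at m (\<lambda>i. X i \<omega>) j \<and> (\<forall>l\<in>{j<..<Suc j + d}. X l \<omega> \<le> X j \<omega>)) * \<phi> (X j \<omega>) \<partial>M) =
    (\<integral>\<^sup>+\<omega>. of_bool (record_at m (\<lambda>i. X i \<omega>) j) * (emeasure D {..X j \<omega>} ^ d * \<phi> (X j \<omega>)) \<partial>M)"
  using assms
proof (induction d arbitrary: \<phi>)
  case 0
  have "{j<..<Suc j} = {}" by auto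
  then show ?case by simp
next
  case (Suc d)
  note [measurable] = Suc.prems
  define k where "k = Suc j + d"
  then have k: "{j<..<Suc j + Suc d} = insert k {j<..<k}" "j < k" by auto
  have "(\<integral>\<^sup>+\<omega>. of_bool (record_at m (\<lambda>i. X i \<omega>) j \<and> (\<forall>l\<in>{j<..<Suc j + Suc d}. X l \<omega> \<le> X j \<omega>)) * \<phi> (X j \<omega>) \<partial>M)
    = (\<integral>\<^sup>+\<omega>. of_bool (record_at m (\<lambda>i. X i \<omega>) j \<and> (\<forall>l\<in>{j<..<k}. X l \<omega> \<le> X j \<omega>))
        * (\<lambda>(x, y). of_bool (y \<le> x) * \<phi> x) (X j \<omega>, X k \<omega>) \<partial>M)"
    unfolding k(1) by (intro nn_integral_cong) auto
  also have "\<dots> = (\<integral>\<^sup>+\<omega>. of_bool (record_at m (\<lambda>i. X i \<omega>) j \<and> (\<forall>l\<in>{j<..<k}. X l \<omega> \<le> X j \<omega>))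
        * (\<integral>\<^sup>+y. (\<lambda>(x, y). of_bool (y \<le> x) * \<phi> x) (X j \<omega>, y) \<partial>D) \<partial>M)"
    by (rule nn_integral_peel_record) (measurable, rule k)
  also have "\<dots> = (\<integral>\<^sup>+\<omega>. of_bool (record_at m (\<lambda>i. X i \<omega>) j \<and> (\<forall>l\<in>{j<..<k}. X l \<omega> \<le> X j \<omega>))
        * (emeasure D {..X j \<omega>} * \<phi> (X j \<omega>)) \<partial>M)"
    by (simp add: nn_integral_multc nn_integral_of_bool atMost_def)
  \<comment> \<open>The factor gained from \<open>X k\<close> is absorbed into the test function;
    the induction is over all \<phi> for this purpose.\<close>
  also have "\<dots> = (\<integral>\<^sup>+\<omega>. of_bool (record_at m (\<lambda>i. X i \<omega>) j) *
      (emeasure D {..X j \<omega>} ^ d * (emeasure D {..X j \<omega>} * \<phi> (X j \<omega>))) \<partial>M)"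
    unfolding k_def by (rule Suc.IH) measurable
  finally show ?case by (simp add: mult_ac)
qed

text \<open>The conditional expectation of \<open>f\<close> given a value above \<open>x\<close>,
  before normalisation; the geometric series over the waiting time will supply the division.\<close>

definition tail :: "(real \<Rightarrow> ennreal) \<Rightarrow> real \<Rightarrow> ennreal" where
  "tail f x = (\<integral>\<^sup>+y. f y * of_bool (x < y) \<partial>D)"

lemma measurable_tail [measurable (raw)]:
  assumes [measurable]: "f \<in> borel_measurable borel"
  shows "tail f \<in> borel_measurable borel"
  unfolding tail_def by measurable

text \<open>Averaging over the new record value gives \<open>tail f\<close>; each of the
  \<open>d\<close> observations in between then contributes one factor
  \<open>emeasure D {..X j \<omega>}\<close>.\<close>

lemma nn_integral_next_record:
  fixes f :: "real \<Rightarrow> ennreal"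
  assumes [measurable]: "f \<in> borel_measurable borel"
  shows "(\<integral>\<^sup>+\<omega>. of_bool (record_at m (\<lambda>i. X i \<omega>) j \<and> (\<forall>l\<in>{j<..<Suc j + d}. X l \<omega> \<le> X j \<omega>)
        \<and> X j \<omega> < X (Suc j + d) \<omega>) * f (X (Suc j + d) \<omega>) \<partial>M) =
    (\<integral>\<^sup>+\<omega>. of_bool (record_at m (\<lambda>i. X i \<omega>) j) * (emeasure D {..X j \<omega>} ^ d * tail f (X j \<omega>)) \<partial>M)"
    (is "?lhs = ?rhs")
proof -
  define k where "k = Suc j + d"
  have "?lhs = (\<integral>\<^sup>+\<omega>. of_bool (record_at m (\<lambda>i. X i \<omega>) j \<and> (\<forall>l\<in>{j<..<k}. X l \<omega> \<le> X j \<omega>))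
        * (\<lambda>(x, y). f y * of_bool (x < y)) (X j \<omega>, X k \<omega>) \<partial>M)"
    unfolding k_def[symmetric] by (intro nn_integral_cong) auto
  also have "\<dots> = (\<integral>\<^sup>+\<omega>. of_bool (record_at m (\<lambda>i. X i \<omega>) j \<and> (\<forall>l\<in>{j<..<k}. X l \<omega> \<le> X j \<omega>))
        * (\<integral>\<^sup>+y. (\<lambda>(x, y). f y * of_bool (x < y)) (X j \<omega>, y) \<partial>D) \<partial>M)"
    by (rule nn_integral_peel_record) (measurable, simp add: k_def)
  also have "\<dots> = ?rhs"
    unfolding k_def tail_def[symmetric] prod.case by (rule nn_integral_gap) measurable
  finally show ?thesis .
qed

text \<open>The time of the preceding record is unique, so the events on the right are
  disjoint.\<close>

lemma of_bool_record_at_Suc: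
  "(of_bool (record_at (Suc m) x k) :: ennreal) =
    (\<Sum>j<k. of_bool (record_at m x j \<and> (\<forall>l\<in>{j<..<k}. x l \<le> x j) \<and> x j < x k))"
proof (cases "record_at (Suc m) x k")
  case True
  then obtain i where i: "i < k" "record_at m x i \<and> (\<forall>l\<in>{i<..<k}. x l \<le> x i) \<and> x i < x k"
    by auto
  have "(record_at m x j \<and> (\<forall>l\<in>{j<..<k}. x l \<le> x j) \<and> x j < x k) = (j = i)" for j
    using i enumerate_record_at by blast
  with i(1) True show ?thesis by (simp add: of_bool_def del: record_at.simps)
qed auto

section \<open>Expectations of functions of a record value\<close>

text \<open>The expectation of \<open>f\<close> at record number \<open>m + 1\<close>, on the event that this record exists.\<close>

definition record_integral :: "nat \<Rightarrow> (real \<Rightarrow> ennreal) \<Rightarrow> ennreal" where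
  "record_integral m f = (\<Sum>k. \<integral>\<^sup>+\<omega>. of_bool (record_at m (\<lambda>i. X i \<omega>) k) * f (X k \<omega>) \<partial>M)"

lemma record_integral_0:
  assumes [measurable]: "f \<in> borel_measurable borel"
  shows "record_integral 0 f = (\<integral>\<^sup>+y. f y \<partial>D)"
proof -
  have "record_integral 0 f = (\<integral>\<^sup>+\<omega>. f (X 0 \<omega>) \<partial>M)"
    unfolding record_integral_def by (subst suminf_finite[of "{0}"]) auto
  then show ?thesis by (simp flip: law[of 0] add: nn_integral_distr)
qed

lemma AE_X: "AE y in D. P y \<Longrightarrow> AE \<omega> in M. P (X i \<omega>)"
  by (metis AE_distrD X_measurable law)

text \<open>From value \<open>x\<close> the next record has the law of an observation conditioned to
  exceed \<open>x\<close>. The hypothesis makes \<open>f\<close> an eigenfunction of this transition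
  with eigenvalue \<open>q\<close>.\<close>

lemma record_integral_Suc:
  assumes [measurable]: "f \<in> borel_measurable borel"
    and tail: "AE x in D. measure D {..x} < 1 \<and> tail f x = q * (f x * (1 - emeasure D {..x}))"
  shows "record_integral (Suc m) f = q * record_integral m f"
proof -
  \<comment> \<open>\<open>?T j d\<close> is the contribution of a record at time \<open>j\<close>
    followed by exactly \<open>d\<close> observations that are not records and then the next
    record.\<close>
  let ?T = "\<lambda>j d. \<integral>\<^sup>+\<omega>. of_bool (record_at m (\<lambda>i. X i \<omega>) j) * (emeasure D {..X j \<omega>} ^ d * tail f (X j \<omega>)) \<partial>M"
  have "record_integral (Suc m) f = (\<Sum>k. \<Sum>j<k. ?T j (k - Suc j))"
    unfolding record_integral_def
  proof (rule suminf_cong)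
    fix k
    have "(\<integral>\<^sup>+\<omega>. of_bool (record_at (Suc m) (\<lambda>i. X i \<omega>) k) * f (X k \<omega>) \<partial>M) =
      (\<Sum>j<k. \<integral>\<^sup>+\<omega>. of_bool (record_at m (\<lambda>i. X i \<omega>) j \<and> (\<forall>l\<in>{j<..<k}. X l \<omega> \<le> X j \<omega>)
        \<and> X j \<omega> < X k \<omega>) * f (X k \<omega>) \<partial>M)"
      unfolding of_bool_record_at_Suc sum_distrib_right by (rule nn_integral_sum) measurable
    also have "\<dots> = (\<Sum>j<k. ?T j (k - Suc j))"
    proof (rule sum.cong)
      fix j assume "j \<in> {..<k}"
      then have "Suc j + (k - Suc j) = k" by simp
      with nn_integral_next_record[of f m j "k - Suc j"]
      show "(\<integral>\<^sup>+\<omega>. of_bool (record_at m (\<lambda>i. X i \<omega>) j \<and> (\<forall>l\<in>{j<..<k}. X l \<omega> \<le> X j \<omega>)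
        \<and> X j \<omega> < X k \<omega>) * f (X k \<omega>) \<partial>M) = ?T j (k - Suc j)" by simp
    qed simp
    finally show "(\<integral>\<^sup>+\<omega>. of_bool (record_at (Suc m) (\<lambda>i. X i \<omega>) k) * f (X k \<omega>) \<partial>M) =
      (\<Sum>j<k. ?T j (k - Suc j))" .
  qed
  also have "\<dots> = (\<Sum>j. \<Sum>d. ?T j d)" by (rule suminf_triangle)
  also have "\<dots> = (\<Sum>j. q * (\<integral>\<^sup>+\<omega>. of_bool (record_at m (\<lambda>i. X i \<omega>) j) * f (X j \<omega>) \<partial>M))"
  proof (rule suminf_cong)
    fix j
    have "(\<Sum>d. ?T j d) = (\<integral>\<^sup>+\<omega>. (\<Sum>d. of_bool (record_at m (\<lambda>i. X i \<omega>) j) *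
        (emeasure D {..X j \<omega>} ^ d * tail f (X j \<omega>))) \<partial>M)"
    proof (rule nn_integral_suminf[symmetric])
      fix d
      have "(\<lambda>x. emeasure D {..x} ^ d * tail f x) \<in> borel_measurable borel" by measurable
      then have [measurable]: "(\<lambda>\<omega>. emeasure D {..X j \<omega>} ^ d * tail f (X j \<omega>)) \<in> borel_measurable M"
        by (rule measurable_compose[OF X_measurable])
      show "(\<lambda>\<omega>. of_bool (record_at m (\<lambda>i. X i \<omega>) j) *
          (emeasure D {..X j \<omega>} ^ d * tail f (X j \<omega>))) \<in> borel_measurable M" by measurable
    qed
    also have "\<dots> = (\<integral>\<^sup>+\<omega>. q * (of_bool (record_at m (\<lambda>i. X i \<omega>) j) * f (X j \<omega>)) \<partial>M)"
    proof (rule nn_integral_cong_AE, rule AE_mp[OF AE_X[OF tail, of j]], rule AE_I2, rule impI, elim conjE)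
      fix \<omega>
      let ?x = "X j \<omega>"
      assume lt: "measure D {..?x} < 1" and tl: "tail f ?x = q * (f ?x * (1 - emeasure D {..?x}))"
      \<comment> \<open>\<open>p\<close> is the chance that one observation beats the current
        record; \<open>1 / p\<close> is the mean waiting time and cancels the factor
        \<open>p\<close> in \<open>tail f\<close>.\<close>
      define p where "p = 1 - measure D {..?x}"
      have p: "0 < p" "p \<le> 1" using lt by (auto simp: p_def)
      have F: "emeasure D {..?x} = ennreal (1 - p)" by (simp add: p_def D.emeasure_eq_measure)
      have "1 - ennreal (1 - p) = ennreal p" using p by (simp add: ennreal_minus flip: ennreal_1)
      then have "(\<Sum>d. emeasure D {..?x} ^ d * tail f ?x) = ennreal (1 / p) * (q * (f ?x * ennreal p))"
        unfolding tl by (simp add: F suminf_geometric_ennreal[OF p])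
      also have "\<dots> = (ennreal (1 / p) * ennreal p) * (q * f ?x)" by (simp only: mult_ac)
      also have "ennreal (1 / p) * ennreal p = 1" using p by (simp flip: ennreal_mult)
      finally show "(\<Sum>d. of_bool (record_at m (\<lambda>i. X i \<omega>) j) * (emeasure D {..?x} ^ d * tail f ?x)) =
          q * (of_bool (record_at m (\<lambda>i. X i \<omega>) j) * f ?x)"
        by (simp add: mult_ac)
    qed
    also have "\<dots> = q * (\<integral>\<^sup>+\<omega>. of_bool (record_at m (\<lambda>i. X i \<omega>) j) * f (X j \<omega>) \<partial>M)"
      by (rule nn_integral_cmult) measurable
    finally show "(\<Sum>d. ?T j d) = q * (\<integral>\<^sup>+\<omega>. of_bool (record_at m (\<lambda>i. X i \<omega>) j) * f (X j \<omega>) \<partial>M)" .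
  qed
  finally show ?thesis by (simp add: record_integral_def)
qed

text \<open>For the constant 1, \<open>record_integral\<close> adds the probabilities of disjoint
  events, so its value is the probability that the record occurs at some time.\<close>

lemma record_exists:
  assumes "record_integral m (\<lambda>_. 1) = 1"
  shows "AE \<omega> in M. \<exists>k. record_at m (\<lambda>i. X i \<omega>) k"
proof -
  have eq: "(\<Sum>k. of_bool (record_at m x k)) = (of_bool (\<exists>k. record_at m x k) :: ennreal)" for x
  proof (cases "\<exists>k. record_at m x k")
    case True
    then obtain i where "record_at m x i" by auto
    then have "record_at m x k = (k = i)" for k using enumerate_record_at by blast
    then show ?thesis by (subst suminf_finite[of "{i}"]) auto
  qed simp
  have "1 = (\<integral>\<^sup>+\<omega>. of_bool (\<exists>k. record_at m (\<lambda>i. X i \<omega>) k) \<partial>M)"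
    using assms unfolding record_integral_def eq[symmetric] by (subst nn_integral_suminf) auto
  also have "\<dots> = emeasure M {\<omega>\<in>space M. \<exists>k. record_at m (\<lambda>i. X i \<omega>) k}"
    by (rule nn_integral_of_bool) measurable
  finally show ?thesis
    by (subst prob_Collect_eq_1[symmetric]) (auto simp: emeasure_eq_measure)
qed

lemma measurable_upper_record [measurable]:
  "(\<lambda>\<omega>. upper_record (\<lambda>i. X i \<omega>) m) \<in> borel_measurable M"
proof -
  have "(\<lambda>\<omega>. enumerate (record_times (\<lambda>i. X i \<omega>)) (m - 1)) \<in> M \<rightarrow>\<^sub>M count_space UNIV"
    by (rule measurable_enumerate) (simp add: record_times_def)
  then show ?thesis
    unfolding upper_record_def by (rule measurable_compose_countable[rotated]) measurable
qed

text \<open>Almost surely exactly one time carries the record, so the series has one relevant term.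
  The index shifts because \<open>record_at\<close> counts records from 0 and
  \<open>upper_record\<close> from 1.\<close>

lemma nn_integral_upper_record:
  assumes [measurable]: "f \<in> borel_measurable borel" and "record_integral m (\<lambda>_. 1) = 1"
  shows "(\<integral>\<^sup>+\<omega>. f (upper_record (\<lambda>i. X i \<omega>) (Suc m)) \<partial>M) = record_integral m f"
proof -
  have "(\<integral>\<^sup>+\<omega>. f (upper_record (\<lambda>i. X i \<omega>) (Suc m)) \<partial>M) =
      (\<integral>\<^sup>+\<omega>. (\<Sum>k. of_bool (record_at m (\<lambda>i. X i \<omega>) k) * f (X k \<omega>)) \<partial>M)"
  proof (rule nn_integral_cong_AE, rule AE_mp[OF record_exists[OF assms(2)]], rule AE_I2, rule impI)
    fix \<omega> assume "\<exists>k. record_at m (\<lambda>i. X i \<omega>) k"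
    then obtain j where j: "record_at m (\<lambda>i. X i \<omega>) j" by auto
    then have "record_at m (\<lambda>i. X i \<omega>) k = (k = j)" for k using enumerate_record_at by blast
    then show "f (upper_record (\<lambda>i. X i \<omega>) (Suc m)) = (\<Sum>k. of_bool (record_at m (\<lambda>i. X i \<omega>) k) * f (X k \<omega>))"
      by (subst suminf_finite[of "{j}"]) (auto simp: upper_record_def enumerate_record_at[OF j])
  qed
  also have "\<dots> = record_integral m f"
    unfolding record_integral_def by (rule nn_integral_suminf) measurable
  finally show ?thesis .
qed

end

section \<open>Exponential families\<close>

context exponential_family_first_type
begin

abbreviation T :: "real \<Rightarrow> real" where "T \<equiv> zero_ext a b A"

lemma a_in_support: "a \<in> support a b"
  using end_points by (simp add: support_def)

lemma support_interval: "x \<in> support a b \<Longrightarrow> a \<le> y \<Longrightarrow> y \<le> x \<Longrightarrow> y \<in> support a b"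
  by (auto simp: support_def) (metis ereal_less_eq(3) le_less_trans)

lemma support_borel [measurable]: "support a b \<in> sets borel"
  unfolding support_def by measurable

lemma A_nonneg: "x \<in> support a b \<Longrightarrow> 0 \<le> A x"
  using mono_onD[OF A_mono a_in_support, of x] A_left by (simp add: support_def)

lemma T_nonneg: "0 \<le> T x"
  by (simp add: zero_ext_def A_nonneg)

lemma A_continuous: "continuous_on (support a b) A"
  using A_deriv by (meson DERIV_continuous_on)

lemma T_borel [measurable]: "T \<in> borel_measurable borel"
  unfolding zero_ext_def
  by (intro borel_measurable_continuous_on_if support_borel A_continuous continuous_on_const)

text \<open>Intermediate value theorem on \<open>{a..r}\<close>, where \<open>A a = 0\<close> and
  divergence at \<open>b\<close> provides \<open>r\<close> with \<open>t < A r\<close>. The points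
  obtained serve as quantiles.\<close>

lemma A_surj:
  assumes "0 \<le> t"
  shows "\<exists>c\<in>support a b. A c = t"
proof -
  have "eventually (\<lambda>y. t < A (real_of_ereal y)) (at_left b)"
    using A_right by (simp add: filterlim_at_top_dense)
  then obtain z where z: "z < b" "\<And>y. z < y \<Longrightarrow> y < b \<Longrightarrow> t < A (real_of_ereal y)"
    unfolding eventually_at_left[OF end_points] by auto
  \<comment> \<open>Lying strictly between a real number and \<open>b\<close>, this point is finite
    even if \<open>b\<close> is infinite.\<close>
  obtain y where y: "max z (ereal a) < y" "y < b"
    using z(1) end_points dense[of "max z (ereal a)" b] by auto
  then obtain r where r: "y = ereal r" by (cases y) auto
  have "r \<in> support a b" "t < A r"
    using y r z(2)[of y] by (auto simp: support_def)
  moreover have "continuous_on {a..r} A"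
    using A_continuous by (rule continuous_on_subset) (use support_interval[OF \<open>r \<in> _\<close>] in auto)
  ultimately obtain c where "a \<le> c" "c \<le> r" "A c = t"
    using IVT'[of A a t r] assms A_left by (auto simp: support_def)
  then show ?thesis using support_interval[OF \<open>r \<in> _\<close>] by auto
qed

end

locale family_law = exponential_family_first_type + D: prob_space D for D :: "real measure" +
  fixes \<theta> :: real
  assumes param: "\<theta> \<in> \<Theta>" and sets_D: "sets D = sets borel"
    and cdf_D: "\<And>y. cdf D y = family_cdf a b A B \<theta> y"
begin

abbreviation rate :: real where "rate \<equiv> B \<theta>"

lemma rate_pos: "0 < rate"
  using B_pos param .

lemma D_cong [measurable_cong]: "sets D = sets borel"
  by (rule sets_D)

lemma D_space [simp]: "space D = UNIV"
  using sets_eq_imp_space_eq[OF sets_D] by simp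

section \<open>The exponential law of \<open>A\<close> at an observation\<close>

lemma measure_atMost:
  "x \<in> support a b \<Longrightarrow> measure D {..x} = 1 - exp (- (rate * A x))"
  using cdf_D[of x] by (simp add: cdf_def family_cdf_def support_def)

text \<open>Up to the null set \<open>{..a}\<close>, the support contains \<open>{..c}\<close> for
  each \<open>c\<close> in it. Choosing \<open>A c = t\<close> and letting \<open>t\<close> tend to
  infinity exhausts the mass.\<close>

lemma AE_support: "AE y in D. y \<in> support a b"
proof -
  have le: "1 - exp (- (rate * t)) \<le> measure D (support a b)" if "0 \<le> t" for t
  proof -
    obtain c where c: "c \<in> support a b" "A c = t" using A_surj[OF \<open>0 \<le> t\<close>] by auto
    have "{..c} \<subseteq> {..a} \<union> support a b"
    proof
      fix y assume "y \<in> {..c}"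
      then show "y \<in> {..a} \<union> support a b"
        using support_interval[OF c(1), of y] by (cases "a \<le> y") auto
    qed
    then have "measure D {..c} \<le> measure D ({..a} \<union> support a b)"
      by (intro D.finite_measure_mono) (auto simp: sets_D)
    also have "\<dots> \<le> measure D {..a} + measure D (support a b)"
      by (intro measure_Un_le) (auto simp: sets_D)
    finally show ?thesis
      by (simp add: measure_atMost c a_in_support A_left)
  qed
  have "((\<lambda>t. 1 - exp (- (rate * t))) \<longlongrightarrow> 1) at_top"
    using rate_pos by real_asymp
  then have "1 \<le> measure D (support a b)"
    by (rule tendsto_upperbound) (auto intro: eventually_mono[OF eventually_ge_at_top[of 0]] le)
  then have "measure D (support a b) = 1" by (intro antisym) auto
  then show ?thesis by (intro D.AE_prob_1)
qed

text \<open>Since \<open>A\<close> may have flat pieces, the event \<open>T y \<le> t\<close> is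
  only sandwiched, almost surely, between \<open>{..c}\<close> with \<open>A c = t\<close> and
  \<open>{..d}\<close> with \<open>A d = u > t\<close>. Letting \<open>u\<close> decrease to
  \<open>t\<close> closes the gap.\<close>

lemma T_exponential: "distributed D lborel T (exponential_density rate)"
proof -
  have "measure D {y \<in> space D. T y \<le> t} = 1 - exp (- t * rate)" if t: "0 \<le> t" for t
  proof (rule antisym)
    obtain c where c: "c \<in> support a b" "A c = t" using A_surj[OF t] by auto
    have "measure D {..c} \<le> measure D {y \<in> space D. T y \<le> t}"
    proof (rule D.finite_measure_mono_AE)
      show "AE y in D. y \<in> {..c} \<longrightarrow> y \<in> {y \<in> space D. T y \<le> t}"
        using AE_support by eventually_elim (use c mono_onD[OF A_mono _ c(1)] in \<open>auto simp: zero_ext_def\<close>)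
    qed measurable
    then show "1 - exp (- t * rate) \<le> measure D {y \<in> space D. T y \<le> t}"
      using measure_atMost[OF c(1)] c(2) by (simp add: mult.commute)
  next
    have "measure D {y \<in> space D. T y \<le> t} \<le> 1 - exp (- u * rate)" if u: "t < u" for u
    proof -
      obtain d where d: "d \<in> support a b" "A d = u" using A_surj[of u] t u by auto
      have "measure D {y \<in> space D. T y \<le> t} \<le> measure D {..d}"
      proof (rule D.finite_measure_mono_AE)
        show "AE y in D. y \<in> {y \<in> space D. T y \<le> t} \<longrightarrow> y \<in> {..d}"
          using AE_support
        proof eventually_elim
          fix y assume y: "y \<in> support a b"
          show "y \<in> {y \<in> space D. T y \<le> t} \<longrightarrow> y \<in> {..d}"
            using mono_onD[OF A_mono d(1) y] d(2) u y by (cases "d \<le> y") (auto simp: zero_ext_def)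
        qed
      qed (simp add: sets_D)
      then show ?thesis using measure_atMost[OF d(1)] d(2) by (simp add: mult.commute)
    qed
    moreover have "((\<lambda>u. 1 - exp (- u * rate)) \<longlongrightarrow> 1 - exp (- t * rate)) (at_right t)"
      by (intro tendsto_intros)
    ultimately show "measure D {y \<in> space D. T y \<le> t} \<le> 1 - exp (- t * rate)"
      by (intro tendsto_lowerbound[of "\<lambda>u. 1 - exp (- u * rate)" _ "at_right t"])
        (auto simp: eventually_at_right_less intro: eventually_mono[OF eventually_at_right_less])
  qed
  then show ?thesis
    using rate_pos by (subst D.exponential_distributed_iff) auto
qed

lemma measure_greaterThan:
  assumes "x \<in> support a b"
  shows "measure D {x<..} = exp (- (rate * A x))"
proof -
  have "{x<..} = space D - {..x}" by auto
  then show ?thesis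
    using D.prob_compl[of "{..x}"] measure_atMost[OF assms] by (simp add: sets_D)
qed

section \<open>Loss of memory\<close>

text \<open>Flat pieces of \<open>A\<close> are null sets, so the orders on the support and on the values of \<open>A\<close> agree.\<close>

lemma AE_less_iff:
  assumes x: "x \<in> support a b"
  shows "AE y in D. x < y \<longleftrightarrow> T x < T y"
proof -
  let ?U = "{y \<in> space D. T x < T y}"
  have imp: "T x < T y \<longrightarrow> x < y" if "y \<in> support a b" for y
    using mono_onD[OF A_mono that x] that x by (auto simp: zero_ext_def not_less[symmetric])
  have [measurable]: "?U \<in> sets D" by measurable
  \<comment> \<open>By monotonicity \<open>?U\<close> lies in \<open>{x<..}\<close> almost surely.
    Both events have probability \<open>exp (- T x * rate)\<close>, so their difference is
    null.\<close>
  have "measure D ({x<..} \<inter> ?U) = measure D ?U"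
    by (intro D.finite_measure_eq_AE) (use AE_support imp in \<open>auto simp: sets_D elim!: eventually_mono\<close>)
  also have "\<dots> = exp (- T x * rate)"
    using D.exponential_distributedD_gt[OF T_exponential T_nonneg rate_pos] .
  also have "\<dots> = measure D {x<..}"
    using x by (simp add: measure_greaterThan zero_ext_def mult.commute)
  finally have "measure D ({x<..} - ({x<..} \<inter> ?U)) = 0"
    by (subst D.finite_measure_Diff) (auto simp: sets_D)
  then have "AE y in D. y \<notin> {x<..} - ({x<..} \<inter> ?U)"
    by (subst (asm) D.prob_eq_0) (auto simp: sets_D)
  with AE_support show ?thesis
    by eventually_elim (use imp in auto)
qed

text \<open>The eigenfunction identity required by \<open>record_integral_Suc\<close>. By
  \<open>AE_less_iff\<close> the integral runs over an exponential variable beyond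
  \<open>T x\<close>; its value splits off \<open>exp (- (rate * T x))\<close>, the probability of
  exceeding \<open>x\<close>.\<close>

lemma exponential_tail:
  assumes x: "x \<in> support a b" and s: "0 \<le> s"
  shows "(\<integral>\<^sup>+y. ennreal (exp (- (s * T y))) * of_bool (x < y) \<partial>D) =
    ennreal (rate / (rate + s)) * (ennreal (exp (- (s * T x))) * (1 - emeasure D {..x}))"
proof -
  let ?t = "T x" and ?r = "rate + s"
  have r: "0 < ?r" using rate_pos s by simp
  have "(\<integral>\<^sup>+y. ennreal (exp (- (s * T y))) * of_bool (x < y) \<partial>D) =
      (\<integral>\<^sup>+y. ennreal (exp (- (s * T y))) * of_bool (?t < T y) \<partial>D)"
    using AE_less_iff[OF x] by (intro nn_integral_cong_AE) (auto elim!: eventually_mono)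
  also have "\<dots> = (\<integral>\<^sup>+u. ennreal (exponential_density rate u) * (ennreal (exp (- (s * u))) * of_bool (?t < u)) \<partial>lborel)"
    by (rule distributed_nn_integral[OF T_exponential, symmetric]) measurable
  \<comment> \<open>As \<open>T x\<close> is nonnegative, the density has its exponential form on
    the whole range; adding the null point \<open>T x\<close> closes the half-line for the
    fundamental theorem of calculus.\<close>
  also have "\<dots> = (\<integral>\<^sup>+u. ennreal (rate * exp (- (?r * u))) * indicator {?t..} u \<partial>lborel)"
  proof (rule nn_integral_cong_AE, rule AE_mp[OF AE_lborel_singleton[of ?t]], rule AE_I2, rule impI)
    fix u assume "u \<noteq> ?t"
    then show "ennreal (exponential_density rate u) * (ennreal (exp (- (s * u))) * of_bool (?t < u)) =
        ennreal (rate * exp (- (?r * u))) * indicator {?t..} u"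
      using T_nonneg[of x] rate_pos
      by (auto simp: exponential_density_def indicator_def ennreal_mult[symmetric] exp_add[symmetric]
          mult.assoc algebra_simps)
  qed
  also have "\<dots> = ennreal (0 - (- (rate / ?r) * exp (- (?r * ?t))))"
  proof (rule nn_integral_FTC_atLeast[where F = "\<lambda>u. - (rate / ?r) * exp (- (?r * u))"])
    show "(\<lambda>u. rate * exp (- (?r * u))) \<in> borel_measurable borel" by measurable
    show "0 \<le> rate * exp (- (?r * u))" for u using rate_pos by simp
    show "((\<lambda>u. - (rate / ?r) * exp (- (?r * u))) \<longlongrightarrow> 0) at_top"
      using r by real_asymp
    show "((\<lambda>u. - (rate / ?r) * exp (- (?r * u))) has_real_derivative rate * exp (- (?r * u))) (at u)" for u
    proof (rule DERIV_cong)
      show "((\<lambda>u. - (rate / ?r) * exp (- (?r * u))) has_real_derivative - (rate / ?r) * (exp (- (?r * u)) * - ?r)) (at u)"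
        using less_imp_neq[OF r, symmetric] by (auto intro!: derivative_eq_intros)
      have "rate / ?r * ?r = rate" using less_imp_neq[OF r, symmetric] by simp
      then show "- (rate / ?r) * (exp (- (?r * u)) * - ?r) = rate * exp (- (?r * u))"
        by (simp only: minus_mult_minus mult_minus_left mult_minus_right minus_minus mult_ac)
          (simp only: mult.assoc[symmetric])
    qed
  qed
  also have "\<dots> = ennreal (rate / ?r) * (ennreal (exp (- (s * ?t))) * ennreal (exp (- (rate * ?t))))"
  proof -
    have "exp (- (?r * ?t)) = exp (- (s * ?t)) * exp (- (rate * ?t))"
      by (subst exp_add[symmetric]) (simp add: algebra_simps)
    then have "0 - - (rate / ?r) * exp (- (?r * ?t)) = rate / ?r * (exp (- (s * ?t)) * exp (- (rate * ?t)))"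
      by (simp only: mult_minus_left diff_0 minus_minus)
    then show ?thesis
      using r rate_pos by (simp only:) (subst ennreal_mult, simp_all add: ennreal_mult)
  qed
  also have "ennreal (exp (- (rate * ?t))) = 1 - emeasure D {..x}"
  proof -
    have "0 \<le> measure D {..x}" by simp
    then have "1 - emeasure D {..x} = ennreal (1 - measure D {..x})"
      unfolding D.emeasure_eq_measure ennreal_1[symmetric] by (rule ennreal_minus)
    then show ?thesis using x by (simp add: measure_atMost zero_ext_def)
  qed
  finally show ?thesis .
qed

text \<open>The case \<open>x = a\<close> of \<open>exponential_tail\<close>, where
  \<open>T a = 0\<close> and \<open>{..a}\<close> is null.\<close>

lemma laplace_T:
  assumes s: "0 \<le> s"
  shows "(\<integral>\<^sup>+y. ennreal (exp (- (s * T y))) \<partial>D) = ennreal (rate / (rate + s))"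
proof -
  have 0: "measure D {..a} = 0" using measure_atMost[OF a_in_support] A_left by simp
  then have "AE y in D. y \<notin> {..a}"
    by (subst (asm) D.prob_eq_0) (auto simp: sets_D)
  then have "(\<integral>\<^sup>+y. ennreal (exp (- (s * T y))) \<partial>D) =
      (\<integral>\<^sup>+y. ennreal (exp (- (s * T y))) * of_bool (a < y) \<partial>D)"
    by (intro nn_integral_cong_AE) (auto elim!: eventually_mono)
  then show ?thesis
    using exponential_tail[OF a_in_support s] 0 a_in_support A_left
    by (simp add: zero_ext_def D.emeasure_eq_measure)
qed

end

section \<open>Records from an exponential family\<close>

locale record_sample = iid_sequence M X D + family_law a b A A' B \<Theta> D \<theta>
  for M :: "'a measure" and X D a b A A' B \<Theta> \<theta>
begin

definition R :: "nat \<Rightarrow> 'a \<Rightarrow> real" where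
  "R m \<omega> = upper_record (\<lambda>i. X i \<omega>) m"

lemma R_measurable [measurable]: "R m \<in> borel_measurable M"
  unfolding R_def by measurable

text \<open>Every new record contributes one eigenvalue; the first observation already contributes
  one, hence the exponent \<open>Suc m\<close>.\<close>

lemma record_integral_laplace:
  assumes s: "0 \<le> s"
  shows "record_integral m (\<lambda>y. ennreal (exp (- (s * T y)))) = ennreal ((rate / (rate + s)) ^ Suc m)"
proof (induction m)
  case 0
  show ?case by (simp add: record_integral_0 laplace_T[OF s])
next
  case (Suc m)
  have "AE x in D. measure D {..x} < 1 \<and> tail (\<lambda>y. ennreal (exp (- (s * T y)))) x =
      ennreal (rate / (rate + s)) * (ennreal (exp (- (s * T x))) * (1 - emeasure D {..x}))"
    using AE_support by eventually_elim (auto simp: measure_atMost tail_def exponential_tail[OF _ s])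
  then have "record_integral (Suc m) (\<lambda>y. ennreal (exp (- (s * T y)))) =
      ennreal (rate / (rate + s)) * record_integral m (\<lambda>y. ennreal (exp (- (s * T y))))"
    by (intro record_integral_Suc) measurable
  with Suc show ?case
    using s rate_pos by (simp add: ennreal_mult[symmetric])
qed

text \<open>The right side is the Laplace transform of the Gamma law with shape \<open>m\<close> and
  scale \<open>1 / rate\<close>.\<close>

lemma laplace_R:
  assumes s: "0 \<le> s" and m: "0 < m"
  shows "expectation (\<lambda>\<omega>. exp (- (s * T (R m \<omega>)))) = (rate / (rate + s)) ^ m"
proof -
  obtain k where k: "m = Suc k" using m by (cases m) auto
  \<comment> \<open>The value \<open>s = 0\<close> gives total mass one: the record exists almost
    surely.\<close>
  have "record_integral k (\<lambda>_. 1) = 1"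
    using record_integral_laplace[of 0 k] rate_pos by simp
  then have "(\<integral>\<^sup>+\<omega>. ennreal (exp (- (s * T (R m \<omega>)))) \<partial>M) = ennreal ((rate / (rate + s)) ^ m)"
    using nn_integral_upper_record[of "\<lambda>y. ennreal (exp (- (s * T y)))" k] record_integral_laplace[OF s, of k]
    by (simp add: R_def k)
  then show ?thesis
    using s rate_pos by (subst integral_eq_nn_integral) auto
qed

text \<open>A bounded transform of the sample mean type: its \<open>k\<close>-th moment is the
  Laplace transform of \<open>T (R m \<omega>)\<close> at \<open>k / m\<close>.\<close>

definition Z :: "nat \<Rightarrow> 'a \<Rightarrow> real" where
  "Z m \<omega> = exp (- (T (R m \<omega>) / real m))"

lemma Z_measurable [measurable]: "Z m \<in> borel_measurable M"
  unfolding Z_def by measurable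

lemma expectation_Z_power:
  assumes "0 < m"
  shows "expectation (\<lambda>\<omega>. Z m \<omega> ^ k) = (rate / (rate + real k / real m)) ^ m"
proof -
  have "Z m \<omega> ^ k = exp (- (real k / real m * T (R m \<omega>)))" for \<omega>
    by (simp add: Z_def exp_of_nat_mult[symmetric])
  then show ?thesis using laplace_R[of "real k / real m" m] assms by simp
qed

text \<open>The moment is the inverse of \<open>(1 + (k / rate) / m) ^ m\<close>, which tends to
  \<open>exp (k / rate)\<close>.\<close>

lemma expectation_Z_power_limit:
  "(\<lambda>m. expectation (\<lambda>\<omega>. Z m \<omega> ^ k)) \<longlonglongrightarrow> exp (- 1 / rate) ^ k"
proof -
  have "(\<lambda>m. inverse ((1 + (real k / rate) / real m) ^ m)) \<longlonglongrightarrow> inverse (exp (real k / rate))"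
    by (intro tendsto_inverse tendsto_exp_limit_sequentially) simp
  moreover have "inverse (exp (real k / rate)) = exp (- 1 / rate) ^ k"
    by (simp add: exp_minus[symmetric] exp_of_nat_mult[symmetric])
  moreover have "eventually (\<lambda>m. inverse ((1 + (real k / rate) / real m) ^ m) = expectation (\<lambda>\<omega>. Z m \<omega> ^ k)) sequentially"
    using eventually_gt_at_top[of 0]
  proof eventually_elim
    fix m :: nat assume m: "0 < m"
    have "rate / (rate + real k / real m) = inverse (1 + (real k / rate) / real m)"
      using rate_pos m by (simp add: field_simps)
    then show "inverse ((1 + (real k / rate) / real m) ^ m) = expectation (\<lambda>\<omega>. Z m \<omega> ^ k)"
      by (simp add: expectation_Z_power[OF m] power_inverse)
  qed
  ultimately show ?thesis by (auto elim: Lim_transform_eventually)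
qed

text \<open>Expanding the square leaves the first two moments, whose limits cancel.\<close>

lemma Z_L2: "(\<lambda>m. expectation (\<lambda>\<omega>. (Z m \<omega> - exp (- 1 / rate))\<^sup>2)) \<longlonglongrightarrow> 0"
proof -
  let ?c = "exp (- 1 / rate)"
  have int: "integrable M (\<lambda>\<omega>. Z m \<omega> ^ k)" for m k
    by (rule integrable_const_bound[of _ 1])
      (auto simp: Z_def T_nonneg power_le_one)
  have "expectation (\<lambda>\<omega>. (Z m \<omega> - ?c)\<^sup>2) =
      expectation (\<lambda>\<omega>. Z m \<omega> ^ 2) - 2 * ?c * expectation (\<lambda>\<omega>. Z m \<omega> ^ 1) + ?c\<^sup>2" for m
    using int[of m 2] int[of m 1]
    by (simp add: power2_diff prob_space mult.assoc mult.commute[of _ ?c])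
  moreover have "(\<lambda>m. expectation (\<lambda>\<omega>. Z m \<omega> ^ 2) - 2 * ?c * expectation (\<lambda>\<omega>. Z m \<omega> ^ 1) + ?c\<^sup>2)
      \<longlonglongrightarrow> ?c ^ 2 - 2 * ?c * ?c ^ 1 + ?c\<^sup>2"
    by (intro tendsto_intros expectation_Z_power_limit)
  ultimately show ?thesis by (simp add: power2_eq_square)
qed

text \<open>Continuous mapping at a single point: a deviation of \<open>Y m\<close> beyond
  \<epsilon> forces one of \<open>Z m\<close> by at least \<delta>, and Markov's inequality for the
  squared deviation bounds its probability.\<close>

lemma converges_in_probability_of_Z:
  assumes meas: "\<And>m. Y m \<in> borel_measurable M"
    and Y: "\<And>m \<omega>. 0 < m \<Longrightarrow> Y m \<omega> = g (Z m \<omega>)"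
    and g: "isCont g (exp (- 1 / rate))"
  shows "converges_in_probability M Y (g (exp (- 1 / rate)))"
  unfolding converges_in_probability_def
proof (intro conjI allI impI meas)
  note [measurable] = meas
  let ?c = "exp (- 1 / rate)"
  fix \<epsilon> :: real assume "0 < \<epsilon>"
  with g obtain \<delta> where \<delta>: "0 < \<delta>" "\<And>z. \<bar>z - ?c\<bar> < \<delta> \<Longrightarrow> \<bar>g z - g ?c\<bar> < \<epsilon>"
    unfolding continuous_at_eps_delta dist_real_def by meson
  have bound: "measure M {\<omega> \<in> space M. \<bar>Y m \<omega> - g ?c\<bar> > \<epsilon>} \<le> expectation (\<lambda>\<omega>. (Z m \<omega> - ?c)\<^sup>2) / \<delta>\<^sup>2"
    if m: "0 < m" for m
  proof -
    have "measure M {\<omega> \<in> space M. \<bar>Y m \<omega> - g ?c\<bar> > \<epsilon>} \<le> measure M {\<omega> \<in> space M. (Z m \<omega> - ?c)\<^sup>2 \<ge> \<delta>\<^sup>2}"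
    proof (rule finite_measure_mono)
      show "{\<omega> \<in> space M. \<bar>Y m \<omega> - g ?c\<bar> > \<epsilon>} \<subseteq> {\<omega> \<in> space M. (Z m \<omega> - ?c)\<^sup>2 \<ge> \<delta>\<^sup>2}"
      proof safe
        fix \<omega> assume "\<bar>Y m \<omega> - g ?c\<bar> > \<epsilon>"
        then have "\<delta> \<le> \<bar>Z m \<omega> - ?c\<bar>" using \<delta>(2)[of "Z m \<omega>"] Y[OF m, of \<omega>] by force
        then show "\<delta>\<^sup>2 \<le> (Z m \<omega> - ?c)\<^sup>2" using \<delta>(1) by (simp add: abs_le_square_iff[symmetric])
      qed
    qed measurable
    also have "\<dots> \<le> expectation (\<lambda>\<omega>. (Z m \<omega> - ?c)\<^sup>2) / \<delta>\<^sup>2"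
    proof (rule integral_Markov_inequality_measure)
      have "\<bar>Z m \<omega> - ?c\<bar> \<le> 1" for \<omega>
      proof -
        have "0 < Z m \<omega>" "Z m \<omega> \<le> 1" "0 < ?c" "?c \<le> 1"
          using rate_pos by (auto simp: Z_def T_nonneg)
        then show ?thesis by linarith
      qed
      then show "integrable M (\<lambda>\<omega>. (Z m \<omega> - ?c)\<^sup>2)"
        by (intro integrable_const_bound[of _ 1]) (auto simp: power_le_one_iff abs_square_le_1)
    qed (use \<delta>(1) in auto)
    finally show ?thesis .
  qed
  show "(\<lambda>m. measure M {\<omega> \<in> space M. \<bar>Y m \<omega> - g ?c\<bar> > \<epsilon>}) \<longlonglongrightarrow> 0"
  proof (rule tendsto_sandwich[OF _ _ tendsto_const])
    show "(\<lambda>m. expectation (\<lambda>\<omega>. (Z m \<omega> - ?c)\<^sup>2) / \<delta>\<^sup>2) \<longlonglongrightarrow> 0"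
      using tendsto_divide[OF Z_L2 tendsto_const[of "\<delta>\<^sup>2"]] \<delta>(1) by simp
    show "eventually (\<lambda>m. measure M {\<omega> \<in> space M. \<bar>Y m \<omega> - g ?c\<bar> > \<epsilon>} \<le>
        expectation (\<lambda>\<omega>. (Z m \<omega> - ?c)\<^sup>2) / \<delta>\<^sup>2) sequentially"
      using eventually_gt_at_top[of 0] by eventually_elim (rule bound)
  qed auto
qed

section \<open>Consistency of the two estimators\<close>

text \<open>If \<open>T (R m \<omega>) = 0\<close> or \<open>m = 0\<close>, both sides are \<open>0\<close> since \<open>x / 0 = 0\<close>.\<close>

lemma ratio_eq: "real m / T (R m \<omega>) = - 1 / ln (Z m \<omega>)"
  by (simp add: Z_def)

text \<open>Here \<open>ln\<close> takes the nonzero value \<open>- 1 / rate\<close>, and the ratio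
  equals \<open>rate\<close>.\<close>

lemma isCont_ratio: "isCont (\<lambda>z. - 1 / ln z) (exp (- 1 / rate))"
  using rate_pos by (auto intro!: continuous_intros)

lemma pdf_MLE_consistent:
  "converges_in_probability M (\<lambda>m \<omega>. pdf_MLE a b A A' m (\<lambda>m. R m \<omega>) x) (family_pdf a b A A' B \<theta> x)"
proof -
  \<comment> \<open>The estimator with \<open>- 1 / ln z\<close> in place of
    \<open>m / T (R m \<omega>)\<close>; at \<open>exp (- 1 / rate)\<close> this becomes
    \<open>rate\<close> and gives the true density.\<close>
  define g where "g z = (if x \<in> support a b then A' x * (- 1 / ln z) * exp (- (A x * (- 1 / ln z))) else 0)" for z
  have "converges_in_probability M (\<lambda>m \<omega>. pdf_MLE a b A A' m (\<lambda>m. R m \<omega>) x) (g (exp (- 1 / rate)))"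
  proof (rule converges_in_probability_of_Z)
    show "(\<lambda>\<omega>. pdf_MLE a b A A' m (\<lambda>m. R m \<omega>) x) \<in> borel_measurable M" for m
      unfolding pdf_MLE_def by measurable
    show "pdf_MLE a b A A' m (\<lambda>m. R m \<omega>) x = g (Z m \<omega>)" for m \<omega>
      unfolding g_def ratio_eq[symmetric] by (simp add: pdf_MLE_def mult_ac)
    show "isCont g (exp (- 1 / rate))"
      unfolding g_def using isCont_ratio rate_pos by (cases "x \<in> support a b") (auto intro!: continuous_intros)
  qed
  also have "g (exp (- 1 / rate)) = family_pdf a b A A' B \<theta> x"
    by (simp add: g_def family_pdf_def)
  finally show ?thesis .
qed

lemma cdf_MLE_consistent:
  "converges_in_probability M (\<lambda>m \<omega>. cdf_MLE a b A m (\<lambda>m. R m \<omega>) x) (family_cdf a b A B \<theta> x)"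
proof -
  define g where "g z = (if x < a then 0 else if ereal x < b then 1 - exp (- (A x * (- 1 / ln z))) else 1)" for z
  have "converges_in_probability M (\<lambda>m \<omega>. cdf_MLE a b A m (\<lambda>m. R m \<omega>) x) (g (exp (- 1 / rate)))"
  proof (rule converges_in_probability_of_Z)
    show "(\<lambda>\<omega>. cdf_MLE a b A m (\<lambda>m. R m \<omega>) x) \<in> borel_measurable M" for m
      unfolding cdf_MLE_def by measurable
    show "cdf_MLE a b A m (\<lambda>m. R m \<omega>) x = g (Z m \<omega>)" for m \<omega>
      unfolding g_def ratio_eq[symmetric] by (simp add: cdf_MLE_def mult_ac)
    show "isCont g (exp (- 1 / rate))"
      unfolding g_def using isCont_ratio rate_pos by (cases "x < a"; cases "ereal x < b") (auto intro!: continuous_intros)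
  qed
  also have "g (exp (- 1 / rate)) = family_cdf a b A B \<theta> x"
    by (simp add: g_def family_cdf_def mult.commute)
  finally show ?thesis .
qed

end

theorem theorem6:
  fixes M :: "'a measure" and X :: "nat \<Rightarrow> 'a \<Rightarrow> real"
    and a :: real and b :: ereal and A A' B :: "real \<Rightarrow> real"
    and \<Theta> :: "real set" and \<theta> :: real
  assumes family: "exponential_family_first_type a b A A' B \<Theta>"
    and param: "\<theta> \<in> \<Theta>"
    and prob: "prob_space M"
    and indep: "prob_space.indep_vars M (\<lambda>_. borel) X UNIV"
    and distr: "\<And>i y. cdf (distr M borel (X i)) y = family_cdf a b A B \<theta> y"
  defines "R \<equiv> \<lambda>\<omega>. upper_record (\<lambda>i. X i \<omega>)"
  shows "\<forall>x. converges_in_probability M (\<lambda>m \<omega>. pdf_MLE a b A A' m (R \<omega>) x)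
               (family_pdf a b A A' B \<theta> x)
           \<and> converges_in_probability M (\<lambda>m \<omega>. cdf_MLE a b A m (R \<omega>) x)
               (family_cdf a b A B \<theta> x)"
proof -
  interpret prob_space M by (rule prob)
  have [measurable]: "X i \<in> borel_measurable M" for i
    using indep by (auto simp: indep_vars_def)
  \<comment> \<open>A distribution function determines its law, so all observations share the law of
    \<open>X 0\<close>, which takes the place of \<open>D\<close>.\<close>
  have law: "distr M borel (X i) = distr M borel (X 0)" for i
    by (intro cdf_unique) (auto simp: distr fun_eq_iff)
  interpret family: exponential_family_first_type a b A A' B \<Theta> by (rule family)
  interpret D: prob_space "distr M borel (X 0)" by (rule prob_space_distr) simp
  interpret S: record_sample M X "distr M borel (X 0)" a b A A' B \<Theta> \<theta>
    by unfold_locales (rule indep law param distr sets_distr)+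
  have "R \<omega> = (\<lambda>m. S.R m \<omega>)" for \<omega>
    by (simp add: R_def S.R_def fun_eq_iff)
  then show ?thesis
    using S.pdf_MLE_consistent S.cdf_MLE_consistent by simp
qed

end
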